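(* Let $\Pi^*$ be a set of pure (deterministic stationary) optimal policies on a unichain Markov decision process $\mathcal M$ with finite state and action sets. Then any policy that, at each visit in each state $i$, chooses (randomly, possibly in a time-dependent way) an action $a$ such that there is a policy $\pi\in \Pi^*$ with $a=\pi(i)$, is optimal, i.e. its long-run average reward equals the optimal average reward.
   Context: A Markov decision process on a finite state set $S$ with finite action set $A$ has transition probabilities $p_a(i,j)$ and mean rewards $r_a(i)$. A pure stationary policy is a map $\pi:S\to A$, inducing the Markov chain with transition matrix $(p_{\pi(i)}(i,j))_{i,j\in S}$. The MDP is unichain if for every such policy this matrix is irreducible; then it has a unique invariant, strictly positive distribution $\mu$. The average reward of $\pi$ is $V(\pi)=\sum_{i\in S}\mu(i)r_{\pi(i)}(i)$; $\pi^\circ$ is optimal if $V(\pi)\le V(\pi^\circ)$ for all stationary policies $\pi$, and the optimal value $V^*=V(\pi^\circ)$ is also the best achievable long-run average reward over all (possibly time-dependent) policies. *)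

theory Defs
  imports "HOL-Probability.Probability"
begin

text \<open>
  An MDP with state type \<open>'s\<close> and action type \<open>'a\<close> (both of class \<open>finite\<close> in the theorem) is
  given by \<open>p\<close> and \<open>r\<close>, where \<open>pmf (p a i) j\<close> is the probability of moving from \<open>i\<close> to \<open>j\<close> under
  action \<open>a\<close> and \<open>r a i\<close> is the mean reward. Every action is available in every state.
\<close>

text \<open>Row \<open>i\<close> of the \<open>n\<close>-th power of the transition matrix \<open>(pmf (K i) j)\<close>.\<close>

primrec nstep :: "('s \<Rightarrow> 's pmf) \<Rightarrow> nat \<Rightarrow> 's \<Rightarrow> 's pmf" where
  "nstep K 0 i = return_pmf i"
| "nstep K (Suc n) i = bind_pmf (nstep K n i) K"

definition irreducible_chain :: "('s \<Rightarrow> 's pmf) \<Rightarrow> bool" where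
  "irreducible_chain K \<longleftrightarrow> (\<forall>i j. \<exists>n. pmf (nstep K n i) j > 0)"

definition invariant_distr :: "('s \<Rightarrow> 's pmf) \<Rightarrow> 's pmf \<Rightarrow> bool" where
  "invariant_distr K \<mu> \<longleftrightarrow> bind_pmf \<mu> K = \<mu>"

definition policy_chain :: "('a \<Rightarrow> 's \<Rightarrow> 's pmf) \<Rightarrow> ('s \<Rightarrow> 'a) \<Rightarrow> 's \<Rightarrow> 's pmf" where
  "policy_chain p \<pi> i = p (\<pi> i) i"

definition unichain :: "('a \<Rightarrow> 's \<Rightarrow> 's pmf) \<Rightarrow> bool" where
  "unichain p \<longleftrightarrow> (\<forall>\<pi>. irreducible_chain (policy_chain p \<pi>))"

text \<open>The description below is proper only when the invariant distribution is unique, as it is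
  for every policy of a finite unichain MDP.\<close>

definition stat_distr :: "('a \<Rightarrow> 's \<Rightarrow> 's pmf) \<Rightarrow> ('s \<Rightarrow> 'a) \<Rightarrow> 's pmf" where
  "stat_distr p \<pi> = (THE \<mu>. invariant_distr (policy_chain p \<pi>) \<mu>)"

definition policy_value ::
    "('a \<Rightarrow> 's::finite \<Rightarrow> 's pmf) \<Rightarrow> ('a \<Rightarrow> 's \<Rightarrow> real) \<Rightarrow> ('s \<Rightarrow> 'a) \<Rightarrow> real" where
  "policy_value p r \<pi> = (\<Sum>i\<in>UNIV. pmf (stat_distr p \<pi>) i * r (\<pi> i) i)"

definition optimal_pure ::
    "('a \<Rightarrow> 's::finite \<Rightarrow> 's pmf) \<Rightarrow> ('a \<Rightarrow> 's \<Rightarrow> real) \<Rightarrow> ('s \<Rightarrow> 'a) \<Rightarrow> bool" where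
  "optimal_pure p r \<pi>opt \<longleftrightarrow> (\<forall>\<pi>. policy_value p r \<pi> \<le> policy_value p r \<pi>opt)"

definition optimal_value ::
    "('a::finite \<Rightarrow> 's::finite \<Rightarrow> 's pmf) \<Rightarrow> ('a \<Rightarrow> 's \<Rightarrow> real) \<Rightarrow> real" where
  "optimal_value p r = Max (range (policy_value p r))"

text \<open>
  A general policy is randomized and may depend on the whole past (hence in particular on time):
  \<open>\<sigma> h i\<close> is the distribution of the action chosen in the current state \<open>i\<close> after the history \<open>h\<close>
  of state-action pairs, oldest first, so that \<open>length h\<close> is the current time.
\<close>

type_synonym ('s, 'a) policy = "('s \<times> 'a) list \<Rightarrow> 's \<Rightarrow> 'a pmf"

text \<open>Joint law of the history before time \<open>t\<close> and the state at time \<open>t\<close>, when the initial state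
  has law \<open>\<nu>\<close>.\<close>

primrec history ::
    "('a \<Rightarrow> 's \<Rightarrow> 's pmf) \<Rightarrow> ('s, 'a) policy \<Rightarrow> 's pmf \<Rightarrow> nat \<Rightarrow> (('s \<times> 'a) list \<times> 's) pmf" where
  "history p \<sigma> \<nu> 0 = map_pmf (\<lambda>i. ([], i)) \<nu>"
| "history p \<sigma> \<nu> (Suc t) =
     bind_pmf (history p \<sigma> \<nu> t) (\<lambda>(h, i).
     bind_pmf (\<sigma> h i) (\<lambda>a.
     map_pmf (\<lambda>j. (h @ [(i, a)], j)) (p a i)))"

definition state_action ::
    "('a \<Rightarrow> 's \<Rightarrow> 's pmf) \<Rightarrow> ('s, 'a) policy \<Rightarrow> 's pmf \<Rightarrow> nat \<Rightarrow> ('s \<times> 'a) pmf" where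
  "state_action p \<sigma> \<nu> t =
     bind_pmf (history p \<sigma> \<nu> t) (\<lambda>(h, i). map_pmf (\<lambda>a. (i, a)) (\<sigma> h i))"

definition expected_reward ::
    "('a \<Rightarrow> 's \<Rightarrow> 's pmf) \<Rightarrow> ('a \<Rightarrow> 's \<Rightarrow> real) \<Rightarrow> ('s, 'a) policy \<Rightarrow> 's pmf \<Rightarrow> nat \<Rightarrow> real" where
  "expected_reward p r \<sigma> \<nu> t =
     measure_pmf.expectation (state_action p \<sigma> \<nu> t) (\<lambda>(i, a). r a i)"

text \<open>The limit is required to exist, not just its \<open>liminf\<close> or \<open>limsup\<close>.\<close>

definition has_average_reward ::
    "('a \<Rightarrow> 's \<Rightarrow> 's pmf) \<Rightarrow> ('a \<Rightarrow> 's \<Rightarrow> real) \<Rightarrow> ('s, 'a) policy \<Rightarrow> 's pmf \<Rightarrow> real \<Rightarrow> bool" where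
  "has_average_reward p r \<sigma> \<nu> g \<longleftrightarrow>
     (\<lambda>T. (\<Sum>t<T. expected_reward p r \<sigma> \<nu> t) / real T) \<longlonglongrightarrow> g"

end

theory Submission
  imports Defs
begin

text \<open>
  Fix one optimal policy and solve its Poisson equation \<open>g + h = r + P h\<close>; then \<open>g\<close> is the
  optimal value. An action with \<open>r a i + P\<^sub>a h i > g + h i\<close> would strictly improve the policy, since
  invariant distributions are strictly positive, so \<open>r a i + P\<^sub>a h i \<le> g + h i\<close> throughout. Integrating
  this against the strictly positive invariant distribution of any optimal policy \<open>\<pi>\<close> shows that
  equality holds for the actions \<open>\<pi> i\<close>. Hence under the mixed policy the expected reward at time
  \<open>t\<close> is \<open>g + E h(X\<^sub>t) - E h(X\<^sub>t\<^sub>+\<^sub>1)\<close>, and the sum telescopes up to a bounded error.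
\<close>

section \<open>Expectations over finite types\<close>

lemma integrable_pmf_finite_type [simp]:
  fixes f :: "'s::finite \<Rightarrow> real"
  shows "integrable (measure_pmf M) f"
  by (rule integrable_measure_pmf_finite) simp

lemma expectation_finite_type:
  fixes f :: "'s::finite \<Rightarrow> real"
  shows "measure_pmf.expectation M f = (\<Sum>j\<in>UNIV. pmf M j * f j)"
  by (subst integral_measure_pmf[of UNIV]) auto

lemma expectation_bind_finite_type:
  fixes f :: "'s::finite \<Rightarrow> real" and M :: "'t::finite pmf"
  shows "measure_pmf.expectation (bind_pmf M K) f
           = measure_pmf.expectation M (\<lambda>i. measure_pmf.expectation (K i) f)"
proof -
  have "(\<Sum>j\<in>UNIV. (\<Sum>i\<in>UNIV. pmf M i * pmf (K i) j) * f j)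
      = (\<Sum>i\<in>UNIV. pmf M i * (\<Sum>j\<in>UNIV. pmf (K i) j * f j))"
    unfolding sum_distrib_left sum_distrib_right
    by (subst sum.swap) (simp add: mult.assoc)
  then show ?thesis
    by (simp add: expectation_finite_type pmf_bind)
qed

lemma expectation_nonneg_eq_0_imp:
  fixes f :: "'s::finite \<Rightarrow> real"
  assumes "measure_pmf.expectation M f = 0"
    and "\<And>j. 0 \<le> f j" and "j \<in> set_pmf M"
  shows "f j = 0"
proof -
  have "\<forall>j\<in>UNIV. pmf M j * f j = 0"
    using assms(1,2) by (subst (asm) expectation_finite_type, subst (asm) sum_nonneg_eq_0_iff) auto
  then show ?thesis
    using assms(3) by (auto simp: set_pmf_iff)
qed

subsection \<open>Invariant distributions and the Poisson equation\<close>

lemma finite_type_attains_max: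
  fixes h :: "'s::finite \<Rightarrow> real"
  shows "\<exists>m. \<forall>j. h j \<le> h m"
proof -
  have "Max (range h) \<in> range h"
    by (rule Max_in) auto
  then obtain m where "Max (range h) = h m" by blast
  then show ?thesis
    by (metis Max_ge finite finite_imageI rangeI)
qed

text \<open>No average of \<open>h\<close> exceeds its maximum. This weak maximum principle is what
  pins down the constants in Poisson equations.\<close>

lemma exists_ge_expectation:
  fixes h :: "'s::finite \<Rightarrow> real"
  shows "\<exists>i. measure_pmf.expectation (K i) h \<le> h i"
proof -
  obtain i where i: "\<And>j. h j \<le> h i"
    using finite_type_attains_max[of h] by blast
  have "measure_pmf.expectation (K i) h \<le> measure_pmf.expectation (K i) (\<lambda>_. h i)"
    by (rule integral_mono) (auto simp: i)
  then show ?thesis by auto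
qed

lemma exists_le_expectation:
  fixes h :: "'s::finite \<Rightarrow> real"
  shows "\<exists>i. h i \<le> measure_pmf.expectation (K i) h"
  using exists_ge_expectation[of K "\<lambda>j. - h j"] by auto

text \<open>Maximum principle: at a maximizer \<open>h\<close> equals its own average, so all
  successors are maximizers, and irreducibility spreads this to every state.\<close>

lemma harmonic_imp_constant:
  fixes h :: "'s::finite \<Rightarrow> real"
  assumes irr: "irreducible_chain K"
    and harm: "\<And>i. h i = measure_pmf.expectation (K i) h"
  shows "h i = h j"
proof -
  obtain m where m: "\<And>j. h j \<le> h m"
    using finite_type_attains_max[of h] by blast
  have step: "h k = h m" if "h l = h m" "k \<in> set_pmf (K l)" for k l
  proof -
    have "measure_pmf.expectation (K l) (\<lambda>j. h m - h j) = 0"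
      using that(1) unfolding harm[of l] by simp
    then have "h m - h k = 0"
      by (rule expectation_nonneg_eq_0_imp) (use m that(2) in auto)
    then show ?thesis by simp
  qed
  have reach: "h k = h m" if "k \<in> set_pmf (nstep K n m)" for k n
    using that by (induction n arbitrary: k) (auto dest: step[rotated])
  have "h k = h m" for k
    using irr reach[of k] unfolding irreducible_chain_def by (metis pmf_positive_iff)
  then show ?thesis by metis
qed

lemma poisson_equation:
  fixes f :: "'s::finite \<Rightarrow> real"
  assumes irr: "irreducible_chain K"
  shows "\<exists>g h. \<forall>i. g + h i = f i + measure_pmf.expectation (K i) h"
proof -
  fix z :: 's
  \<comment> \<open>Adding \<open>h z\<close> to \<open>(I - P) h\<close> normalizes \<open>h\<close> and makes the operator injective, hence
    surjective; the added term then serves as the constant \<open>g\<close>.\<close>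
  define L :: "real^'s \<Rightarrow> real^'s" where
    "L v = (\<chi> i. v $ i - measure_pmf.expectation (K i) (\<lambda>j. v $ j) + v $ z)" for v
  have lin: "linear L"
    by (rule linearI) (auto simp: L_def vec_eq_iff algebra_simps)
  have "inj L"
  proof (subst linear_injective_0[OF lin], intro allI impI)
    fix v assume "L v = 0"
    then have v: "v $ i + v $ z = measure_pmf.expectation (K i) (\<lambda>j. v $ j)" for i
      by (simp add: L_def vec_eq_iff algebra_simps)
    \<comment> \<open>\<open>P v - v\<close> is the constant \<open>v $ z\<close>, which is at most
      0 at a maximizer of \<open>v\<close> and at least 0 at a minimizer.\<close>
    have vz: "v $ z = 0"
      using exists_ge_expectation[of K "\<lambda>j. v $ j"] exists_le_expectation[of "\<lambda>j. v $ j" K]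
      unfolding v[symmetric] by auto
    have "v $ i = measure_pmf.expectation (K i) (\<lambda>j. v $ j)" for i
      using v[of i] vz by simp
    then have "v $ i = v $ z" for i
      by (rule harmonic_imp_constant[OF irr])
    then show "v = 0" by (simp add: vec_eq_iff vz)
  qed
  then obtain v where "L v = (\<chi> i. f i)"
    using linear_injective_imp_surjective[OF lin] by (metis surjD)
  then have "v $ z + v $ i = f i + measure_pmf.expectation (K i) (\<lambda>j. v $ j)" for i
    by (auto simp: L_def vec_eq_iff algebra_simps)
  then show ?thesis by blast
qed

text \<open>Subtract the equations at a state where \<open>h - h'\<close> is at least its own
  average.\<close>

lemma poisson_constant_mono:
  fixes f f' :: "'s::finite \<Rightarrow> real"
  assumes "\<And>i. g + h i = f i + measure_pmf.expectation (K i) h"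
    and "\<And>i. g' + h' i = f' i + measure_pmf.expectation (K i) h'"
    and "\<And>i. f i \<le> f' i"
  shows "g \<le> g'"
proof -
  obtain i where "measure_pmf.expectation (K i) (\<lambda>j. h j - h' j) \<le> h i - h' i"
    using exists_ge_expectation[of K "\<lambda>j. h j - h' j"] by blast
  then show ?thesis
    using assms(1)[of i] assms(2)[of i] assms(3)[of i] by simp
qed

lemma poisson_constant_unique:
  fixes f :: "'s::finite \<Rightarrow> real"
  assumes "\<And>i. g + h i = f i + measure_pmf.expectation (K i) h"
    and "\<And>i. g' + h' i = f i + measure_pmf.expectation (K i) h'"
  shows "g = g'"
  by (rule antisym; rule poisson_constant_mono) (rule assms order.refl)+

lemma invariant_expectation:
  fixes h :: "'s::finite \<Rightarrow> real"
  assumes "invariant_distr K \<mu>"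
  shows "measure_pmf.expectation \<mu> (\<lambda>i. measure_pmf.expectation (K i) h)
           = measure_pmf.expectation \<mu> h"
  using assms expectation_bind_finite_type[of \<mu> K h] by (simp add: invariant_distr_def)

text \<open>Integrating the equation against \<open>\<mu>\<close> cancels the two \<open>h\<close>
  terms by invariance.\<close>

lemma poisson_constant_eq_expectation:
  fixes f :: "'s::finite \<Rightarrow> real"
  assumes "invariant_distr K \<mu>"
    and "\<And>i. g + h i = f i + measure_pmf.expectation (K i) h"
  shows "measure_pmf.expectation \<mu> f = g"
proof -
  have "f = (\<lambda>i. g + h i - measure_pmf.expectation (K i) h)"
    using assms(2) by (auto simp: fun_eq_iff algebra_simps)
  then show ?thesis
    using invariant_expectation[OF assms(1), of h] by simp
qed

text \<open>The invariant mass of \<open>j\<close> is the constant in the Poisson equation for the indicator of \<open>j\<close>.\<close>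

lemma invariant_distr_exists:
  fixes K :: "'s::finite \<Rightarrow> 's pmf"
  assumes irr: "irreducible_chain K"
  obtains \<mu> where "invariant_distr K \<mu>"
proof -
  have "\<exists>g h. \<forall>i. g + h i = (if i = j then 1 else 0::real) + measure_pmf.expectation (K i) h" for j
    by (rule poisson_equation[OF irr])
  then obtain m H where
    mH: "\<And>j i. m j + H j i = (if i = j then 1 else 0::real) + measure_pmf.expectation (K i) (H j)"
    by metis
  \<comment> \<open>The combination of the \<open>H j\<close> with weights \<open>f j\<close> solves
    the Poisson equation for \<open>f\<close>, so the constant depends linearly on
    \<open>f\<close>.\<close>
  have comb: "(\<Sum>j\<in>UNIV. f j * m j) = g"
    if "\<And>i. g + h i = f i + measure_pmf.expectation (K i) h" for f g h
  proof (rule poisson_constant_unique[OF _ that])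
    fix i
    have "(\<Sum>j\<in>UNIV. f j * (m j + H j i))
        = (\<Sum>j\<in>UNIV. f j * ((if i = j then 1 else 0) + measure_pmf.expectation (K i) (H j)))"
      by (simp add: mH)
    then show "(\<Sum>j\<in>UNIV. f j * m j) + (\<Sum>j\<in>UNIV. f j * H j i)
        = f i + measure_pmf.expectation (K i) (\<lambda>i. \<Sum>j\<in>UNIV. f j * H j i)"
      by (simp add: distrib_left sum.distrib if_distrib[of "\<lambda>x. _ * x"] cong: if_cong)
  qed
  \<comment> \<open>Comparison with the zero function, whose constant is 0.\<close>
  have m_nonneg: "0 \<le> m j" for j
    by (rule poisson_constant_mono[of 0 "\<lambda>_. 0" "\<lambda>_. 0" K, OF _ mH[of j]]) auto
  have m_sum: "(\<Sum>j\<in>UNIV. m j) = 1"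
    using comb[of 1 "\<lambda>_. 0" "\<lambda>_. 1"] by simp
  define \<mu> where "\<mu> = embed_pmf m"
  have pmf_\<mu>: "pmf \<mu> j = m j" for j
    unfolding \<mu>_def
    by (rule pmf_embed_pmf) (auto simp: m_nonneg nn_integral_count_space_finite m_sum)
  \<comment> \<open>The indicator \<open>e\<close> of \<open>j\<close> solves the Poisson equation
    for \<open>e - P e\<close> with constant 0.\<close>
  have inv: "(\<Sum>i\<in>UNIV. pmf (K i) j * m i) = m j" for j
  proof -
    have "(\<Sum>i\<in>UNIV. ((if i = j then 1 else 0) - pmf (K i) j) * m i) = 0"
      by (rule comb[of 0 "\<lambda>i. if i = j then 1 else 0"])
        (simp add: expectation_finite_type if_distrib[of "\<lambda>x. _ * x"] cong: if_cong)
    moreover have "(\<Sum>i\<in>UNIV. (if i = j then 1 else 0) * m i) = m j"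
      by (simp add: if_distrib[of "\<lambda>x. x * _"] cong: if_cong)
    ultimately show ?thesis by (simp add: left_diff_distrib sum_subtractf)
  qed
  have "bind_pmf \<mu> K = \<mu>"
    using inv by (intro pmf_eqI) (simp add: pmf_bind expectation_finite_type pmf_\<mu> mult.commute)
  then show ?thesis
    by (intro that) (simp add: invariant_distr_def)
qed

text \<open>Every invariant distribution must give \<open>j\<close> the Poisson constant of its
  indicator.\<close>

lemma invariant_distr_unique:
  fixes K :: "'s::finite \<Rightarrow> 's pmf"
  assumes irr: "irreducible_chain K" and "invariant_distr K \<mu>" "invariant_distr K \<mu>'"
  shows "\<mu> = \<mu>'"
proof (rule pmf_eqI)
  fix j :: 's
  obtain g h where
    gh: "\<And>i. g + h i = (if i = j then 1 else 0::real) + measure_pmf.expectation (K i) h"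
    using poisson_equation[OF irr, of "\<lambda>i. if i = j then 1 else 0"] by auto
  from poisson_constant_eq_expectation[OF assms(2) gh] poisson_constant_eq_expectation[OF assms(3) gh]
  show "pmf \<mu> j = pmf \<mu>' j"
    by (simp add: expectation_finite_type if_distrib[of "\<lambda>x. _ * x"] cong: if_cong)
qed

lemma invariant_distr_nstep:
  assumes "invariant_distr K \<mu>"
  shows "bind_pmf \<mu> (nstep K n) = \<mu>"
proof (induction n)
  case (Suc n)
  then show ?case
    using assms by (simp add: invariant_distr_def flip: bind_assoc_pmf)
qed (simp add: bind_return_pmf')

text \<open>Some \<open>i\<close> has mass, \<open>n\<close> steps carry part of it to
  \<open>j\<close>, and \<open>n\<close> steps preserve \<open>\<mu>\<close>.\<close>

lemma invariant_distr_positive: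
  assumes "irreducible_chain K" and "invariant_distr K \<mu>"
  shows "j \<in> set_pmf \<mu>"
proof -
  obtain i where i: "i \<in> set_pmf \<mu>"
    using set_pmf_not_empty[of \<mu>] by blast
  obtain n where "pmf (nstep K n i) j > 0"
    using assms(1) by (auto simp: irreducible_chain_def)
  then have "j \<in> set_pmf (bind_pmf \<mu> (nstep K n))"
    using i by (auto simp: pmf_positive_iff)
  then show ?thesis
    by (simp add: invariant_distr_nstep[OF assms(2)])
qed

subsection \<open>Optimality equations\<close>

lemma invariant_stat_distr:
  fixes p :: "'a \<Rightarrow> 's::finite \<Rightarrow> 's pmf"
  assumes "unichain p"
  shows "invariant_distr (policy_chain p \<pi>) (stat_distr p \<pi>)"
proof -
  have irr: "irreducible_chain (policy_chain p \<pi>)"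
    using assms by (simp add: unichain_def)
  obtain \<mu> where "invariant_distr (policy_chain p \<pi>) \<mu>"
    using invariant_distr_exists[OF irr] .
  then have "\<exists>!\<mu>. invariant_distr (policy_chain p \<pi>) \<mu>"
    using invariant_distr_unique[OF irr] by blast
  then show ?thesis
    unfolding stat_distr_def by (rule theI')
qed

lemma policy_value_eq_expectation:
  "policy_value p r \<pi> = measure_pmf.expectation (stat_distr p \<pi>) (\<lambda>i. r (\<pi> i) i)"
  by (simp add: policy_value_def expectation_finite_type)

text \<open>The integrand is the slack in the optimality inequality; invariance cancels the
  \<open>h\<close> terms in its mean.\<close>

lemma policy_value_diff:
  fixes p :: "'a \<Rightarrow> 's::finite \<Rightarrow> 's pmf" and h :: "'s \<Rightarrow> real"
  assumes "unichain p"
  shows "measure_pmf.expectation (stat_distr p \<pi>)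
           (\<lambda>i. g + h i - r (\<pi> i) i - measure_pmf.expectation (p (\<pi> i) i) h)
         = g - policy_value p r \<pi>"
  using invariant_expectation[OF invariant_stat_distr[OF assms, of \<pi>], of h]
  by (simp add: policy_value_eq_expectation policy_chain_def)

text \<open>The slack is nonnegative with mean at most 0, so it vanishes on the support of the
  stationary distribution, which is the whole state space.\<close>

lemma policy_value_le_imp_eq:
  fixes p :: "'a \<Rightarrow> 's::finite \<Rightarrow> 's pmf" and h :: "'s \<Rightarrow> real"
  assumes uni: "unichain p"
    and le: "\<And>i. r (\<pi> i) i + measure_pmf.expectation (p (\<pi> i) i) h \<le> g + h i"
    and ge: "g \<le> policy_value p r \<pi>"
  shows "r (\<pi> i) i + measure_pmf.expectation (p (\<pi> i) i) h = g + h i"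
proof -
  let ?d = "\<lambda>i. g + h i - r (\<pi> i) i - measure_pmf.expectation (p (\<pi> i) i) h"
  have nonneg: "0 \<le> ?d i" for i
    using le[of i] by simp
  have "0 \<le> measure_pmf.expectation (stat_distr p \<pi>) ?d"
    by (intro Bochner_Integration.integral_nonneg nonneg)
  then have 0: "measure_pmf.expectation (stat_distr p \<pi>) ?d = 0"
    using ge by (simp only: policy_value_diff[OF uni])
  have "i \<in> set_pmf (stat_distr p \<pi>)"
    using uni by (intro invariant_distr_positive[OF _ invariant_stat_distr]) (auto simp: unichain_def)
  with expectation_nonneg_eq_0_imp[OF 0 nonneg] show ?thesis
    by fastforce
qed

lemma optimal_pure_bellman:
  fixes p :: "'a \<Rightarrow> 's::finite \<Rightarrow> 's pmf" and h :: "'s \<Rightarrow> real"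
  assumes uni: "unichain p" and opt: "optimal_pure p r \<pi>"
    and poisson: "\<And>i. g + h i = r (\<pi> i) i + measure_pmf.expectation (p (\<pi> i) i) h"
  shows "r a i + measure_pmf.expectation (p a i) h \<le> g + h i"
proof (rule ccontr)
  assume neg: "\<not> ?thesis"
  let ?\<pi>' = "\<pi>(i := a)"
  have g: "policy_value p r \<pi> = g"
    using poisson_constant_eq_expectation[OF invariant_stat_distr[OF uni, of \<pi>],
        of g h "\<lambda>i. r (\<pi> i) i"] poisson
    by (simp add: policy_value_eq_expectation policy_chain_def)
  \<comment> \<open>If \<open>a\<close> improved on \<open>\<pi>\<close> at \<open>i\<close>, negating \<open>r\<close>, \<open>h\<close> and \<open>g\<close> would put \<open>\<pi>(i := a)\<close> under
    the hypotheses of the equality lemma.\<close>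
  have neg_value: "policy_value p (\<lambda>a i. - r a i) ?\<pi>' = - policy_value p r ?\<pi>'"
    by (simp add: policy_value_def sum_negf)
  have "- r (?\<pi>' i) i + measure_pmf.expectation (p (?\<pi>' i) i) (\<lambda>j. - h j) = - g + - h i"
  proof (rule policy_value_le_imp_eq[OF uni, where \<pi> = ?\<pi>' and r = "\<lambda>a i. - r a i"])
    fix j
    \<comment> \<open>Off \<open>i\<close> the policies agree and \<open>poisson\<close> gives
      equality; at \<open>i\<close> this follows from the negated claim.\<close>
    show "- r (?\<pi>' j) j + measure_pmf.expectation (p (?\<pi>' j) j) (\<lambda>j. - h j) \<le> - g + - h j"
      using neg poisson[of j] by (cases "j = i") auto
    show "- g \<le> policy_value p (\<lambda>a i. - r a i) ?\<pi>'"
      using opt g unfolding neg_value by (auto simp: optimal_pure_def)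
  qed
  with neg show False by simp
qed

subsection \<open>Telescoping along the history process\<close>

lemma map_fst_state_action:
  "map_pmf fst (state_action p \<sigma> \<nu> t) = map_pmf snd (history p \<sigma> \<nu> t)"
  by (simp add: state_action_def map_bind_pmf map_pmf_comp case_prod_unfold)
     (simp add: map_pmf_def bind_return_pmf)

lemma bind_state_action:
  "bind_pmf (state_action p \<sigma> \<nu> t) (\<lambda>(i, a). p a i) = map_pmf snd (history p \<sigma> \<nu> (Suc t))"
  by (simp add: state_action_def bind_assoc_pmf map_bind_pmf bind_map_pmf map_pmf_comp
      case_prod_unfold)

text \<open>The equation is assumed only on the support, since a mixed policy satisfies it only for
  actions it may choose.\<close>

lemma expected_reward_telescope:
  fixes p :: "'a::finite \<Rightarrow> 's::finite \<Rightarrow> 's pmf" and h :: "'s \<Rightarrow> real"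
  assumes eq: "\<And>i a. (i, a) \<in> set_pmf (state_action p \<sigma> \<nu> t) \<Longrightarrow>
                 r a i + measure_pmf.expectation (p a i) h = g + h i"
  shows "expected_reward p r \<sigma> \<nu> t
           = g + measure_pmf.expectation (map_pmf snd (history p \<sigma> \<nu> t)) h
               - measure_pmf.expectation (map_pmf snd (history p \<sigma> \<nu> (Suc t))) h"
proof -
  let ?M = "state_action p \<sigma> \<nu> t"
  have "expected_reward p r \<sigma> \<nu> t = measure_pmf.expectation ?M
      (\<lambda>x. g + h (fst x) - measure_pmf.expectation (p (snd x) (fst x)) h)"
    unfolding expected_reward_def using eq
    by (intro integral_cong_AE) (auto simp: AE_measure_pmf_iff algebra_simps)
  also have "\<dots> = g + measure_pmf.expectation (map_pmf fst ?M) h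
      - measure_pmf.expectation (bind_pmf ?M (\<lambda>(i, a). p a i)) h"
    by (simp add: expectation_bind_finite_type case_prod_unfold)
  finally show ?thesis
    by (simp only: map_fst_state_action bind_state_action)
qed

lemma cesaro_telescope:
  fixes e u :: "nat \<Rightarrow> real"
  assumes e: "\<And>t. e t = g + u t - u (Suc t)" and B: "\<And>t. \<bar>u t\<bar> \<le> B"
  shows "(\<lambda>T. (\<Sum>t<T. e t) / real T) \<longlonglongrightarrow> g"
proof -
  have sum: "(\<Sum>t<T. e t) = real T * g + u 0 - u T" for T
    by (induction T) (auto simp: e algebra_simps)
  have "(\<lambda>T. (u 0 - u T) / real T) \<longlonglongrightarrow> 0"
  proof (rule Lim_null_comparison)
    show "\<forall>\<^sub>F T in sequentially. norm ((u 0 - u T) / real T) \<le> 2 * B / real T"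
    proof (intro always_eventually allI)
      fix T
      have "\<bar>u 0 - u T\<bar> \<le> 2 * B"
        using B[of 0] B[of T] by linarith
      then show "norm ((u 0 - u T) / real T) \<le> 2 * B / real T"
        by (simp add: divide_right_mono)
    qed
    show "(\<lambda>T. 2 * B / real T) \<longlonglongrightarrow> 0"
      by (rule lim_const_over_n)
  qed
  then have "(\<lambda>T. g + (u 0 - u T) / real T) \<longlonglongrightarrow> g"
    by (auto intro: tendsto_eq_intros)
  \<comment> \<open>At \<open>T = 0\<close> the averaged sum is 0 by the convention on division,
    while the other sequence is \<open>g\<close>; they agree once \<open>T > 0\<close>.\<close>
  then show ?thesis
    by (rule Lim_transform_eventually)
       (auto simp: sum field_simps intro: eventually_mono[OF eventually_gt_at_top[of 0]])
qed

theorem theorem7: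
  fixes p :: "'a::finite \<Rightarrow> 's::finite \<Rightarrow> 's pmf"
    and r :: "'a \<Rightarrow> 's \<Rightarrow> real"
    and Popt :: "('s \<Rightarrow> 'a) set"
    and \<sigma> :: "('s, 'a) policy"
    and \<nu> :: "'s pmf"
  assumes "unichain p"
    and "\<And>\<pi>. \<pi> \<in> Popt \<Longrightarrow> optimal_pure p r \<pi>"
    and "\<And>t h i a. (h, i) \<in> set_pmf (history p \<sigma> \<nu> t) \<Longrightarrow> a \<in> set_pmf (\<sigma> h i) \<Longrightarrow>
           \<exists>\<pi>\<in>Popt. a = \<pi> i"
  shows "has_average_reward p r \<sigma> \<nu> (optimal_value p r)"
proof -
  let ?g = "optimal_value p r"
  have opt_value: "policy_value p r \<pi> = ?g" if "\<pi> \<in> Popt" for \<pi>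
    using assms(2)[OF that] unfolding optimal_value_def optimal_pure_def
    by (intro Max_eqI[symmetric]) auto
  \<comment> \<open>\<open>Popt\<close> is nonempty because some action is chosen at time 0.\<close>
  obtain i where "i \<in> set_pmf \<nu>"
    using set_pmf_not_empty[of \<nu>] by blast
  moreover obtain a where "a \<in> set_pmf (\<sigma> [] i)"
    using set_pmf_not_empty[of "\<sigma> [] i"] by blast
  ultimately obtain \<pi>\<^sub>0 where \<pi>\<^sub>0: "\<pi>\<^sub>0 \<in> Popt"
    using assms(3)[of "[]" i 0 a] by auto
  have irr: "irreducible_chain (policy_chain p \<pi>\<^sub>0)"
    using assms(1) by (simp add: unichain_def)
  obtain g h where
    gh: "\<And>i. g + h i = r (\<pi>\<^sub>0 i) i + measure_pmf.expectation (policy_chain p \<pi>\<^sub>0 i) h"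
    using poisson_equation[OF irr, of "\<lambda>i. r (\<pi>\<^sub>0 i) i"] by blast
  have "g = ?g"
    using poisson_constant_eq_expectation[OF invariant_stat_distr[OF assms(1)] gh]
    by (simp add: opt_value[OF \<pi>\<^sub>0, symmetric] policy_value_eq_expectation)
  then have bellman: "r a i + measure_pmf.expectation (p a i) h \<le> ?g + h i" for a i
    using gh optimal_pure_bellman[OF assms(1) assms(2)[OF \<pi>\<^sub>0], of g h]
    by (simp add: policy_chain_def)
  have eq: "r a i + measure_pmf.expectation (p a i) h = ?g + h i"
    if ia: "(i, a) \<in> set_pmf (state_action p \<sigma> \<nu> t)" for t i a
  proof -
    obtain hs where "(hs, i) \<in> set_pmf (history p \<sigma> \<nu> t)" "a \<in> set_pmf (\<sigma> hs i)"
      using ia by (auto simp: state_action_def)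
    then obtain \<pi> where "\<pi> \<in> Popt" "a = \<pi> i"
      using assms(3) by blast
    \<comment> \<open>\<open>h\<close> comes from \<open>\<pi>\<^sub>0\<close>, but
      \<open>bellman\<close> covers all actions and \<open>\<pi>\<close> has the same value, so
      equality holds along \<open>\<pi>\<close> too.\<close>
    then show ?thesis
      using policy_value_le_imp_eq[OF assms(1), of r \<pi> h ?g i] bellman opt_value by simp
  qed
  let ?u = "\<lambda>t. measure_pmf.expectation (map_pmf snd (history p \<sigma> \<nu> t)) h"
  have reward: "expected_reward p r \<sigma> \<nu> t = ?g + ?u t - ?u (Suc t)" for t
    by (rule expected_reward_telescope) (rule eq)
  have "\<bar>measure_pmf.expectation M h\<bar> \<le> (\<Sum>j\<in>UNIV. \<bar>h j\<bar>)" for M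
    unfolding expectation_finite_type
    by (rule order.trans[OF sum_abs], rule sum_mono)
       (simp add: abs_mult mult_left_le_one_le pmf_le_1)
  then have "\<bar>?u t\<bar> \<le> (\<Sum>j\<in>UNIV. \<bar>h j\<bar>)" for t .
  then show ?thesis
    unfolding has_average_reward_def
    by (rule cesaro_telescope[where u = ?u, OF reward])
qed

end
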